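(* Let $E=\{1,\dots,s\}$ be a finite set, $\mathbb{T}=\{0,-1,-2,\dots\}$, and let $M=(M_n)_{n\in\mathbb{T}}$ be a sequence of Markov kernels on $E$. The following are equivalent: 1. $\mathrm{card}(\Pi_M)=1$. 2. $\mathbf{P}_\pi(A)=\mathbf{P}_\pi(A)^2=\mathbf{P}_{\tilde\pi}(A)$ for all $(\pi,\tilde\pi,A)\in\Pi_M\times\Pi_M\times\bigcap_{n\in\mathbb{T}}\mathcal{F}^X_{]-\infty,n]}$.
   Context: A sequence of absolute probabilities for $M$ is a family $\pi=(\pi_n)_{n\in\mathbb{T}}$ of probability distributions on $E$ with $\sum_{z\in E}\pi_{n-1}(z)M_n(z,x)=\pi_n(x)$ for all $n\in\mathbb{T}$, $x\in E$. $\Pi_M$ denotes the set of all such sequences (it is always non-empty). Let $\Omega^X=E^{\mathbb{T}}$ with product $\sigma$-algebra $\mathcal{F}^X$ and coordinate process $X=(X_n)_{n\in\mathbb{T}}$; for $I\subset\mathbb{T}$, $\mathcal{F}^X_I=\sigma(X_n;n\in I)$, so $\mathcal{F}^X_{]-\infty,n]}=\sigma(X_k;k\le n)$. For $\pi\in\Pi_M$, $\mathbf{P}_\pi$ is the unique probability measure on $(\Omega^X,\mathcal{F}^X)$ with finite dimensional distributions, for every $n\in\mathbb{T}$ and $(x_n,\dots,x_0)\in E^{|n|+1}$, $$\mathbf{P}_\pi(X_n=x_n,\dots,X_0=x_0)=\pi_n(x_n)\prod_{k=n+1}^0M_k(x_{k-1},x_k).$$ *)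

theory Defs
  imports "HOL-Probability.Probability"
begin

text \<open>
  The time axis 0, -1, -2, ... is a set of integers; time-indexed families are functions on
  \<^typ>\<open>int\<close> of which only the values at nonpositive arguments matter.
  Probability distributions on the state space are probability mass functions on \<^typ>\<open>nat\<close>
  whose support lies in the state space.
\<close>

definition time_axis :: "int set" where
  "time_axis = {..0}"

definition states :: "nat \<Rightarrow> nat set" where
  "states s = {1..s}"

definition dists :: "nat \<Rightarrow> nat pmf set" where
  "dists s = {p. set_pmf p \<subseteq> states s}"

text \<open>\<open>pmf (M n x) y\<close> is the transition probability from \<open>x\<close> at time \<open>n - 1\<close> to \<open>y\<close> at
  time \<open>n\<close>.\<close>

definition markov_kernels :: "nat \<Rightarrow> (int \<Rightarrow> nat \<Rightarrow> nat pmf) \<Rightarrow> bool" where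
  "markov_kernels s M \<longleftrightarrow> (\<forall>n\<in>time_axis. \<forall>x\<in>states s. M n x \<in> dists s)"

text \<open>The extensional function space fixes the irrelevant values at positive times, so that
  the cardinality of this set is that of the set of families indexed by \<^const>\<open>time_axis\<close>.\<close>

definition absolute_probs :: "nat \<Rightarrow> (int \<Rightarrow> nat \<Rightarrow> nat pmf) \<Rightarrow> (int \<Rightarrow> nat pmf) set" where
  "absolute_probs s M =
     {\<pi> \<in> time_axis \<rightarrow>\<^sub>E dists s.
        \<forall>n\<in>time_axis. \<forall>x\<in>states s.
          (\<Sum>z\<in>states s. pmf (\<pi> (n - 1)) z * pmf (M n z) x) = pmf (\<pi> n) x}"

definition path_space :: "nat \<Rightarrow> (int \<Rightarrow> nat) measure" where
  "path_space s = (\<Pi>\<^sub>M n\<in>time_axis. count_space (states s))"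

definition coord_events :: "nat \<Rightarrow> int set \<Rightarrow> (int \<Rightarrow> nat) set set" where
  "coord_events s I =
     sigma_sets (space (path_space s))
       {(\<lambda>\<omega>. \<omega> n) -` B \<inter> space (path_space s) | n B. n \<in> I \<and> B \<subseteq> states s}"

definition remote_past_events :: "nat \<Rightarrow> (int \<Rightarrow> nat) set set" where
  "remote_past_events s = (\<Inter>n\<in>time_axis. coord_events s {..n})"

definition is_path_law ::
    "nat \<Rightarrow> (int \<Rightarrow> nat \<Rightarrow> nat pmf) \<Rightarrow> (int \<Rightarrow> nat pmf) \<Rightarrow> (int \<Rightarrow> nat) measure \<Rightarrow> bool" where
  "is_path_law s M \<pi> P \<longleftrightarrow>
     prob_space P \<and> sets P = sets (path_space s) \<and>
     (\<forall>n\<in>time_axis. \<forall>x \<in> {n..0} \<rightarrow> states s.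
        measure P {\<omega> \<in> space (path_space s). \<forall>k\<in>{n..0}. \<omega> k = x k} =
          pmf (\<pi> n) (x n) * (\<Prod>k\<in>{n+1..0}. pmf (M k (x (k - 1))) (x k)))"

text \<open>For \<open>\<pi> \<in> absolute_probs s M\<close> existence is Kolmogorov's extension theorem, and
  uniqueness holds because the cylinders together with the empty set form an
  intersection-stable generator.\<close>

definition path_law ::
    "nat \<Rightarrow> (int \<Rightarrow> nat \<Rightarrow> nat pmf) \<Rightarrow> (int \<Rightarrow> nat pmf) \<Rightarrow> (int \<Rightarrow> nat) measure" where
  "path_law s M \<pi> = (THE P. is_path_law s M \<pi> P)"

end

theory Submission
  imports Defs
begin

text \<open>
  The laws \<open>P_\<pi>\<close> for different \<open>\<pi> \<in> \<Pi>_M\<close> share their transition probabilities, so they can differ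
  only through information that comes in from the infinitely remote past. The two directions make this
  precise.

  If \<open>\<Pi>_M = {\<pi>}\<close> and \<open>A\<close> is a remote event with \<open>P_\<pi>(A) > 0\<close>, then conditioning on \<open>A\<close> does not affect
  the transitions, because \<open>A\<close> precedes every time \<open>n\<close> (\<open>markov_property\<close>). Hence \<open>P_\<pi>(\<cdot> | A)\<close> is again
  the path law of some sequence of absolute probabilities (\<open>conditioned_law\<close>). This sequence must be
  \<open>\<pi>\<close>, and a path law is determined by its sequence (\<open>is_path_law_unique\<close>), so \<open>P_\<pi>(\<cdot> | A) = P_\<pi>\<close>; evaluated
  at \<open>A\<close> this says \<open>P_\<pi>(A) = 1\<close>.

  Conversely, let \<open>\<Delta> = P_\<pi> - P_\<pi>'\<close>. On the events of \<open>{n..0}\<close> the signed measure \<open>\<Delta>\<close> is maximal at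
  \<open>H_n = {\<pi>'_n(X_n) < \<pi>_n(X_n)}\<close>, because the common transition weights do not affect the sign of
  \<open>\<Delta>\<close> on a path. The decisive point is that the maximiser depends on the single coordinate \<open>X_n\<close>. The maxima
  \<open>\<Delta>(H_n)\<close> increase to a supremum \<open>D\<close> as \<open>n\<close> decreases, and the construction from the Hahn decomposition
  theorem, a limit superior of sets \<open>H_n\<close> along a sequence with summable deficits \<open>D - \<Delta>(H_n)\<close>, gives an
  event \<open>A\<close> with \<open>\<Delta>(A) \<ge> D\<close> that is remote (\<open>ex_remote_event_gap_ge_sup\<close>). So if \<open>P_\<pi>\<close> and \<open>P_\<pi>'\<close>
  agree on remote events, then \<open>D \<le> 0\<close>, and therefore \<open>\<Delta> \<le> 0\<close> on all cylinders; by symmetry \<open>\<pi> = \<pi>'\<close>.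
  That \<open>\<Pi>_M\<close> has an element at all is a compactness argument (\<open>absolute_probs_nonempty\<close>).

  The path laws themselves are constructed in reversed time (\<open>ex_path_law\<close>): since time has a last
  point 0 but no first one, a path is generated by drawing \<open>X_0\<close> and then stepping into the past with
  the time-reversed transition probabilities.
\<close>

section \<open>Past events and their generators\<close>

definition agree :: "nat \<Rightarrow> int \<Rightarrow> int \<Rightarrow> (int \<Rightarrow> nat) \<Rightarrow> (int \<Rightarrow> nat) set" where
  "agree s m n x = {\<omega> \<in> space (path_space s). \<forall>k\<in>{m..n}. \<omega> k = x k}"

text \<open>The empty set is included to make this generator of the past up to time \<open>n\<close> stable under
  intersections: two atoms are disjoint or nested.\<close>

definition past_atoms :: "nat \<Rightarrow> int \<Rightarrow> (int \<Rightarrow> nat) set set" where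
  "past_atoms s n = insert {} {agree s m n x | m x. m \<le> n \<and> x \<in> {m..n} \<rightarrow> states s}"

definition transition_weight :: "(int \<Rightarrow> nat \<Rightarrow> nat pmf) \<Rightarrow> int \<Rightarrow> int \<Rightarrow> (int \<Rightarrow> nat) \<Rightarrow> real" where
  "transition_weight M m n x = (\<Prod>k\<in>{m+1..n}. pmf (M k (x (k - 1))) (x k))"

lemma finite_states [simp]: "finite (states s)"
  by (simp add: states_def)

lemma space_path_space: "space (path_space s) = time_axis \<rightarrow>\<^sub>E states s"
  by (simp add: path_space_def space_PiM)

lemma path_in_states: "\<omega> \<in> space (path_space s) \<Longrightarrow> k \<le> 0 \<Longrightarrow> \<omega> k \<in> states s"
  by (auto simp: space_path_space time_axis_def)

lemma sets_path_space: "sets (path_space s) = coord_events s {..0}"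
proof -
  have "{{f \<in> time_axis \<rightarrow>\<^sub>E states s. f i \<in> A} |i A. i \<in> time_axis \<and> A \<in> sets (count_space (states s))}
     = {(\<lambda>\<omega>. \<omega> n) -` B \<inter> (time_axis \<rightarrow>\<^sub>E states s) | n B. n \<in> time_axis \<and> B \<subseteq> states s}"
    (is "{?F i A | i A. ?C i A} = _")
  proof -
    have "?F n B = (\<lambda>\<omega>. \<omega> n) -` B \<inter> (time_axis \<rightarrow>\<^sub>E states s)" for n B
      by auto
    then show ?thesis by simp
  qed
  then show ?thesis
    unfolding path_space_def coord_events_def sets_PiM_single
    by (simp add: space_PiM) (simp add: time_axis_def)
qed

lemma past_atoms_Pow: "past_atoms s n \<subseteq> Pow (space (path_space s))"
  by (auto simp: past_atoms_def agree_def)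

lemma coord_event_in_coord_events:
  assumes "k \<in> I" "B \<subseteq> states s"
  shows "{\<omega> \<in> space (path_space s). \<omega> k \<in> B} \<in> coord_events s I"
proof -
  have "{\<omega> \<in> space (path_space s). \<omega> k \<in> B} = (\<lambda>\<omega>. \<omega> k) -` B \<inter> space (path_space s)"
    by auto
  with assms show ?thesis
    unfolding coord_events_def by (blast intro: sigma_sets.Basic)
qed

lemma sigma_algebra_coord_events: "sigma_algebra (space (path_space s)) (coord_events s I)"
  unfolding coord_events_def by (intro sigma_algebra_sigma_sets) auto

lemma coord_events_mono: "I \<subseteq> J \<Longrightarrow> coord_events s I \<subseteq> coord_events s J"
  unfolding coord_events_def by (intro sigma_sets_mono') blast

lemma agree_in_coord_events:
  assumes "m \<le> n" "x \<in> {m..n} \<rightarrow> states s"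
  shows "agree s m n x \<in> coord_events s {..n}"
proof -
  interpret sigma_algebra "space (path_space s)" "coord_events s {..n}"
    by (rule sigma_algebra_coord_events)
  have "agree s m n x = (\<Inter>k\<in>{m..n}. {\<omega> \<in> space (path_space s). \<omega> k \<in> {x k}})"
    using assms(1) by (auto simp: agree_def)
  also have "\<dots> \<in> coord_events s {..n}"
    using assms by (intro finite_INT coord_event_in_coord_events) auto
  finally show ?thesis .
qed

text \<open>An event at one time \<open>k \<le> n\<close> is a finite union of atoms, since there are only finitely many
  state sequences between \<open>k\<close> and \<open>n\<close>. For \<open>n = 0\<close> this yields a generator of the whole path space.\<close>

lemma coord_events_eq_past_atoms:
  assumes "n \<le> 0"
  shows "coord_events s {..n} = sigma_sets (space (path_space s)) (past_atoms s n)"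
proof
  interpret sigma_algebra "space (path_space s)" "coord_events s {..n}"
    by (rule sigma_algebra_coord_events)
  have "past_atoms s n \<subseteq> coord_events s {..n}"
    unfolding past_atoms_def using agree_in_coord_events by auto
  then show "sigma_sets (space (path_space s)) (past_atoms s n) \<subseteq> coord_events s {..n}"
    by (rule sigma_sets_subset)
next
  have "(\<lambda>\<omega>. \<omega> k) -` B \<inter> space (path_space s) \<in> sigma_sets (space (path_space s)) (past_atoms s n)"
    if k: "k \<le> n" and B: "B \<subseteq> states s" for k B
  proof -
    let ?F = "{y \<in> {k..n} \<rightarrow>\<^sub>E states s. y k \<in> B}"
    have "(\<lambda>\<omega>. \<omega> k) -` B \<inter> space (path_space s) = \<Union> (agree s k n ` ?F)"
    proof
      show "(\<lambda>\<omega>. \<omega> k) -` B \<inter> space (path_space s) \<subseteq> \<Union> (agree s k n ` ?F)"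
      proof
        fix \<omega> assume w: "\<omega> \<in> (\<lambda>\<omega>. \<omega> k) -` B \<inter> space (path_space s)"
        have "restrict \<omega> {k..n} \<in> ?F" "\<omega> \<in> agree s k n (restrict \<omega> {k..n})"
          using w k assms path_in_states[of \<omega> s] by (auto simp: agree_def)
        then show "\<omega> \<in> \<Union> (agree s k n ` ?F)" by blast
      qed
      show "\<Union> (agree s k n ` ?F) \<subseteq> (\<lambda>\<omega>. \<omega> k) -` B \<inter> space (path_space s)"
        using k by (auto simp: agree_def)
    qed
    also have "\<dots> \<in> sigma_sets (space (path_space s)) (past_atoms s n)"
    proof (rule sigma_sets_UNION)
      have "finite ?F"
        by (rule finite_subset[of _ "{k..n} \<rightarrow>\<^sub>E states s"]) (auto intro: finite_PiE)
      then show "countable (agree s k n ` ?F)"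
        by (intro countable_finite) auto
      fix b assume "b \<in> agree s k n ` ?F"
      with k show "b \<in> sigma_sets (space (path_space s)) (past_atoms s n)"
        by (intro sigma_sets.Basic) (auto simp: past_atoms_def PiE_iff Pi_iff intro!: exI)
    qed
    finally show ?thesis .
  qed
  then show "coord_events s {..n} \<subseteq> sigma_sets (space (path_space s)) (past_atoms s n)"
    unfolding coord_events_def by (intro sigma_sets_mono) auto
qed

lemma agree_Int_agree:
  assumes "l \<le> m"
  shows "agree s l n x \<inter> agree s m n y =
    (if \<forall>k\<in>{m..n}. x k = y k then agree s l n x else {})"
  using assms by (auto simp: agree_def)

lemma Int_stable_past_atoms: "Int_stable (past_atoms s n)"
proof (rule Int_stableI)
  have le: "agree s l n x \<inter> agree s m n y \<in> past_atoms s n"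
    if "l \<le> m" "l \<le> n" "x \<in> {l..n} \<rightarrow> states s" for l m x y
    using that by (auto simp: agree_Int_agree past_atoms_def)
  fix A B assume "A \<in> past_atoms s n" "B \<in> past_atoms s n"
  moreover have "agree s l n x \<inter> agree s m n y \<in> past_atoms s n"
    if "l \<le> n" "x \<in> {l..n} \<rightarrow> states s" "m \<le> n" "y \<in> {m..n} \<rightarrow> states s" for l m x y
    using le[of l m x y] le[of m l y x] that by (cases "l \<le> m") (auto simp: Int_commute)
  ultimately show "A \<inter> B \<in> past_atoms s n"
    unfolding past_atoms_def by blast
qed

lemma space_eq_UN_agree: "n \<le> 0 \<Longrightarrow> space (path_space s) = (\<Union>z\<in>states s. agree s n n (\<lambda>_. z))"
  using path_in_states by (force simp: agree_def)

lemma is_path_law_agree: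
  assumes "is_path_law s M \<pi> P" "n \<le> 0" "x \<in> {n..0} \<rightarrow> states s"
  shows "measure P (agree s n 0 x) = pmf (\<pi> n) (x n) * transition_weight M n 0 x"
  using assms unfolding is_path_law_def agree_def transition_weight_def time_axis_def by auto

text \<open>The defining equations fix the measure on an intersection-stable generator.\<close>

lemma is_path_law_unique:
  assumes P: "is_path_law s M \<pi> P" and Q: "is_path_law s M \<pi> Q"
  shows "P = Q"
proof -
  interpret P: prob_space P using P by (simp add: is_path_law_def)
  interpret Q: prob_space Q using Q by (simp add: is_path_law_def)
  show ?thesis
  proof (rule measure_eqI_generator_eq_countable[OF Int_stable_past_atoms past_atoms_Pow])
    show "emeasure P X = emeasure Q X" if "X \<in> past_atoms s 0" for X
      using that is_path_law_agree[OF P] is_path_law_agree[OF Q]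
      unfolding past_atoms_def P.emeasure_eq_measure Q.emeasure_eq_measure by auto
    show "sets P = sigma_sets (space (path_space s)) (past_atoms s 0)"
      "sets Q = sigma_sets (space (path_space s)) (past_atoms s 0)"
      using P Q sets_path_space coord_events_eq_past_atoms by (auto simp: is_path_law_def)
    show "(\<lambda>z. agree s 0 0 (\<lambda>_. z)) ` states s \<subseteq> past_atoms s 0"
      by (fastforce simp: past_atoms_def)
    show "\<Union> ((\<lambda>z. agree s 0 0 (\<lambda>_. z)) ` states s) = space (path_space s)"
      using space_eq_UN_agree[of 0] by simp
    show "countable ((\<lambda>z. agree s 0 0 (\<lambda>_. z)) ` states s)"
      by (intro countable_finite) auto
  qed simp
qed

lemma path_law_eqI: "is_path_law s M \<pi> P \<Longrightarrow> path_law s M \<pi> = P"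
  unfolding path_law_def using is_path_law_unique by blast

section \<open>The Markov property\<close>

lemma transition_weight_Suc:
  assumes "m \<le> n"
  shows "transition_weight M m (n + 1) x = transition_weight M m n x * pmf (M (n + 1) (x n)) (x (n + 1))"
proof -
  have "{m+1..n+1} = insert (n+1) {m+1..n}" using assms by auto
  then show ?thesis by (simp add: transition_weight_def mult.commute)
qed

lemma transition_weight_first:
  assumes "m \<le> n"
  shows "transition_weight M (m - 1) n x = pmf (M m (x (m - 1))) (x m) * transition_weight M m n x"
proof -
  have "{m - 1 + 1..n} = insert m {m+1..n}" using assms by auto
  then show ?thesis by (simp add: transition_weight_def)
qed

lemma transition_weight_cong:
  assumes "\<And>k. k \<in> {m..n} \<Longrightarrow> x k = y k"
  shows "transition_weight M m n x = transition_weight M m n y"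
  unfolding transition_weight_def by (intro prod.cong) (auto simp: assms)

lemma transition_weight_append:
  assumes "l \<le> n" "n \<le> m"
  shows "transition_weight M l m x = transition_weight M l n x * transition_weight M n m x"
proof -
  have "{l+1..m} = {l+1..n} \<union> {n+1..m}" "{l+1..n} \<inter> {n+1..m} = {}"
    using assms by auto
  then show ?thesis by (simp add: transition_weight_def prod.union_disjoint)
qed

lemma transition_weight_nonneg: "0 \<le> transition_weight M m n x"
  by (simp add: transition_weight_def prod_nonneg)

locale finite_chain =
  fixes s :: nat and M :: "int \<Rightarrow> nat \<Rightarrow> nat pmf"
  assumes states_nonempty: "s \<ge> 1" and kernels: "markov_kernels s M"
begin

lemma kernel_support: "n \<le> 0 \<Longrightarrow> x \<in> states s \<Longrightarrow> set_pmf (M n x) \<subseteq> states s"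
  using kernels by (auto simp: markov_kernels_def time_axis_def dists_def)

lemma kernel_sum: "n \<le> 0 \<Longrightarrow> x \<in> states s \<Longrightarrow> (\<Sum>y\<in>states s. pmf (M n x) y) = 1"
  by (rule sum_pmf_eq_1) (auto dest: kernel_support)

end

locale path_law_of = finite_chain +
  fixes \<pi> :: "int \<Rightarrow> nat pmf" and P :: "(int \<Rightarrow> nat) measure"
  assumes law: "is_path_law s M \<pi> P"
begin

sublocale prob_space P
  using law by (simp add: is_path_law_def)

lemma sets_P: "sets P = coord_events s {..0}"
  using law by (simp add: is_path_law_def sets_path_space)

lemma space_P: "space P = space (path_space s)"
  using law by (intro sets_eq_imp_space_eq) (simp add: is_path_law_def)

lemma coord_events_sets: "n \<le> 0 \<Longrightarrow> A \<in> coord_events s {..n} \<Longrightarrow> A \<in> sets P"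
  using coord_events_mono[of "{..n}" "{..0}" s] sets_P by auto

lemma coord_sets: assumes "k \<le> 0" shows "{\<omega> \<in> space (path_space s). \<omega> k = z} \<in> sets P"
proof (cases "z \<in> states s")
  case True
  have "{\<omega> \<in> space (path_space s). \<omega> k \<in> {z}} \<in> coord_events s {..0}"
    using True assms by (intro coord_event_in_coord_events) auto
  then show ?thesis unfolding sets_P by simp
next
  case False
  with assms have "{\<omega> \<in> space (path_space s). \<omega> k = z} = {}"
    using path_in_states by blast
  then show ?thesis by (simp only: sets.empty_sets)
qed

lemma agree_sets:
  assumes "m \<le> n" "n \<le> 0"
  shows "agree s m n x \<in> sets P"
proof -
  have "agree s m n x = (\<Inter>k\<in>{m..n}. {\<omega> \<in> space (path_space s). \<omega> k = x k})"
    using assms(1) by (auto simp: agree_def)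
  then show ?thesis using assms by (auto intro!: sets.finite_INT coord_sets)
qed

lemma prob_eq_sum_coord:
  assumes "A \<in> sets P" "k \<le> 0"
  shows "prob A = (\<Sum>z\<in>states s. prob (A \<inter> agree s k k (\<lambda>_. z)))"
proof -
  have "A = (\<Union>z\<in>states s. A \<inter> agree s k k (\<lambda>_. z))"
    using sets.sets_into_space[OF assms(1)] space_eq_UN_agree[OF assms(2), of s] unfolding space_P by blast
  also have "prob \<dots> = (\<Sum>z\<in>states s. prob (A \<inter> agree s k k (\<lambda>_. z)))"
    using assms agree_sets[of k k]
    by (intro finite_measure_finite_Union) (auto simp: disjoint_family_on_def agree_def)
  finally show ?thesis .
qed

text \<open>The definition of a path law only concerns windows that end at time 0. Other windows follow by
  summing out the last state, because the rows of the kernels sum to one.\<close>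

lemma prob_agree:
  assumes "m \<le> n" "n \<le> 0" "x \<in> {m..n} \<rightarrow> states s"
  shows "prob (agree s m n x) = pmf (\<pi> m) (x m) * transition_weight M m n x"
  using assms(2,1,3)
proof (induction n arbitrary: x rule: int_le_induct)
  case base
  then show ?case using is_path_law_agree[OF law] by simp
next
  case (step n)
  have "prob (agree s m (n - 1) x) = (\<Sum>z\<in>states s. prob (agree s m (n - 1) x \<inter> agree s n n (\<lambda>_. z)))"
    using step.hyps step.prems by (intro prob_eq_sum_coord agree_sets) auto
  also have "\<dots> = (\<Sum>z\<in>states s. prob (agree s m n (x(n := z))))"
    using step.prems(1) by (intro sum.cong arg_cong[where f=prob]) (auto simp: agree_def)
  also have "\<dots> = (\<Sum>z\<in>states s. pmf (\<pi> m) (x m) * (transition_weight M m (n - 1) x * pmf (M n (x (n - 1))) z))"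
  proof (intro sum.cong refl)
    fix z assume "z \<in> states s"
    then have "prob (agree s m n (x(n := z))) = pmf (\<pi> m) ((x(n := z)) m) * transition_weight M m n (x(n := z))"
      using step.hyps step.prems by (intro step.IH) (auto simp: Pi_iff)
    moreover have "transition_weight M m (n - 1) (x(n := z)) = transition_weight M m (n - 1) x"
      by (rule transition_weight_cong) auto
    ultimately show "prob (agree s m n (x(n := z))) = pmf (\<pi> m) (x m) * (transition_weight M m (n - 1) x * pmf (M n (x (n - 1))) z)"
      using step.prems(1) transition_weight_Suc[of m "n - 1" M "x(n := z)"] by simp
  qed
  also have "\<dots> = pmf (\<pi> m) (x m) * transition_weight M m (n - 1) x * (\<Sum>z\<in>states s. pmf (M n (x (n - 1))) z)"
    by (simp add: sum_distrib_left mult.assoc)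
  also have "(\<Sum>z\<in>states s. pmf (M n (x (n - 1))) z) = 1"
    using step.hyps step.prems by (intro kernel_sum) auto
  finally show ?case by simp
qed

lemma prob_coord: "n \<le> 0 \<Longrightarrow> z \<in> states s \<Longrightarrow> prob (agree s n n (\<lambda>_. z)) = pmf (\<pi> n) z"
  by (subst prob_agree) (auto simp: transition_weight_def)

text \<open>The factor for the times after \<open>n\<close> is the same whatever event of the past up to \<open>n\<close> is added. For
  an atom of the past this is the product formula, and Dynkin's argument extends it to all
  of \<open>\<F>_{..n}\<close>.\<close>

lemma markov_property:
  assumes "n \<le> m" "m \<le> 0" "x \<in> {n..m} \<rightarrow> states s" "A \<in> coord_events s {..n}"
  shows "prob (A \<inter> agree s n m x) = prob (A \<inter> agree s n n x) * transition_weight M n m x"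
proof -
  have n: "n \<le> 0" using assms by simp
  note meas = agree_sets[OF assms(1,2), of x] agree_sets[OF order_refl n, of x]
  have A: "A \<in> sigma_sets (space (path_space s)) (past_atoms s n)"
    using assms(4) coord_events_eq_past_atoms[OF n] by simp
  from Int_stable_past_atoms past_atoms_Pow A show ?thesis
  proof (induction rule: sigma_sets_induct_disjoint)
    case (basic A)
    show ?case
    proof (cases "A = {}")
      case False
      then obtain l y where A: "A = agree s l n y" and l: "l \<le> n" and y: "y \<in> {l..n} \<rightarrow> states s"
        using basic by (auto simp: past_atoms_def)
      show ?thesis
      proof (cases "y n = x n")
        case True
        \<comment> \<open>the two windows share the time \<open>n\<close> and the state there, so they glue together\<close>
        define u where "u k = (if k \<le> n then y k else x k)" for k
        have u: "u \<in> {l..m} \<rightarrow> states s" using y assms(3) by (auto simp: u_def Pi_iff)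
        have 1: "A \<inter> agree s n m x = agree s l m u" 
          using l assms(1) True unfolding A by (force simp: agree_def u_def)
        have 2: "A \<inter> agree s n n x = agree s l n u"
          using l assms(1) True unfolding A by (force simp: agree_def u_def)
        have "transition_weight M l m u = transition_weight M l n u * transition_weight M n m u"
          using l assms(1) by (rule transition_weight_append)
        moreover have "transition_weight M n m u = transition_weight M n m x"
          using True by (intro transition_weight_cong) (auto simp: u_def)
        moreover have "u \<in> {l..n} \<rightarrow> states s" using u assms(1) by auto
        ultimately show ?thesis
          using u l assms(1,2) unfolding 1 2 by (simp add: prob_agree)
      next
        case False
        then have "A \<inter> agree s n m x = {}" "A \<inter> agree s n n x = {}"
          using l assms(1) unfolding A by (force simp: agree_def)+
        then show ?thesis by simp
      qed
    qed simp
  next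
    case empty
    show ?case by simp
  next
    case (compl A)
    then have A: "A \<in> sets P" using coord_events_eq_past_atoms[OF n] coord_events_sets[OF n] by simp
    have *: "prob ((space (path_space s) - A) \<inter> B) = prob B - prob (A \<inter> B)" if "B \<in> sets P" for B
    proof -
      have "(space (path_space s) - A) \<inter> B = B - (A \<inter> B)"
        using sets.sets_into_space[OF that] by (auto simp: space_P)
      then show ?thesis using that A by (simp add: finite_measure_Diff)
    qed
    have "prob (agree s n m x) = prob (agree s n n x) * transition_weight M n m x"
      using assms(1-3) n by (subst (1 2) prob_agree) (auto simp: transition_weight_def)
    with compl show ?case by (simp add: * meas left_diff_distrib)
  next
    case (union A)
    then have A: "A i \<in> sets P" for i
      using coord_events_eq_past_atoms[OF n] coord_events_sets[OF n] by (metis rangeI subsetD)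
    have *: "(\<lambda>i. prob (A i \<inter> B)) sums prob ((\<Union>i. A i) \<inter> B)" if "B \<in> sets P" for B
    proof -
      have "(\<lambda>i. prob (A i \<inter> B)) sums prob (\<Union>i. A i \<inter> B)"
        using that A union(1) by (intro finite_measure_UNION) (auto simp: disjoint_family_on_def)
      then show ?thesis by (simp add: Int_UN_distrib2)
    qed
    show ?case
      using sums_unique2[OF *[OF meas(1)]] sums_mult2[OF *[OF meas(2)]] union(3) by simp
  qed
qed

end

section \<open>Existence of the path laws\<close>

text \<open>The time-reversed transition probabilities given by Bayes' formula: the weight at lag \<open>Suc k\<close> is that of the
  step from state \<open>x\<close> at time \<open>-k\<close> to state \<open>z\<close> at time \<open>-k-1\<close>. Lag 0 draws the state at time 0, where \<open>x\<close> is
  a dummy. From states of probability zero, which are never visited, the step goes to state 1, so that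
  the weights form a probability distribution in every case.\<close>

primrec backward_weight :: "(int \<Rightarrow> nat \<Rightarrow> nat pmf) \<Rightarrow> (int \<Rightarrow> nat pmf) \<Rightarrow> nat \<Rightarrow> nat \<Rightarrow> nat \<Rightarrow> real" where
  "backward_weight M \<pi> 0 x z = pmf (\<pi> 0) z"
| "backward_weight M \<pi> (Suc k) x z =
     (if pmf (\<pi> (- int k)) x = 0 then of_bool (z = 1)
      else pmf (\<pi> (- int k - 1)) z * pmf (M (- int k) z) x / pmf (\<pi> (- int k)) x)"

text \<open>\<open>U\<close> is a table of independent instructions: \<open>U (Suc k, x)\<close> says where to go from state \<open>x\<close> at
  time \<open>-k\<close>. Following the table turns a product measure into the law of a Markov chain.\<close>

primrec backward_path :: "(nat \<times> nat \<Rightarrow> nat) \<Rightarrow> nat \<Rightarrow> nat" where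
  "backward_path U 0 = U (0, 0)"
| "backward_path U (Suc k) = U (Suc k, backward_path U k)"

lemma absolute_probs_dists: "\<pi> \<in> absolute_probs s M \<Longrightarrow> n \<le> 0 \<Longrightarrow> \<pi> n \<in> dists s"
  by (auto simp: absolute_probs_def time_axis_def)

lemma absolute_probs_step:
  "\<pi> \<in> absolute_probs s M \<Longrightarrow> n \<le> 0 \<Longrightarrow> x \<in> states s \<Longrightarrow>
    (\<Sum>z\<in>states s. pmf (\<pi> (n - 1)) z * pmf (M n z) x) = pmf (\<pi> n) x"
  by (auto simp: absolute_probs_def time_axis_def)

lemma sum_pmf_dists: "p \<in> dists s \<Longrightarrow> (\<Sum>z\<in>states s. pmf p z) = 1"
  by (rule sum_pmf_eq_1) (auto simp: dists_def)

lemma pmf_dists_outside: "p \<in> dists s \<Longrightarrow> z \<notin> states s \<Longrightarrow> pmf p z = 0"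
  by (auto simp: dists_def pmf_eq_0_set_pmf)

lemma backward_weight_nonneg: "0 \<le> backward_weight M \<pi> k x z"
  by (cases k) auto

text \<open>Also correct where Bayes' formula divides by zero: there the right-hand side is a summand of a
  vanishing sum of nonnegative numbers.\<close>

lemma backward_weight_balance:
  assumes "\<pi> \<in> absolute_probs s M" "x \<in> states s" "z \<in> states s"
  shows "pmf (\<pi> (- int k)) x * backward_weight M \<pi> (Suc k) x z =
    pmf (\<pi> (- int k - 1)) z * pmf (M (- int k) z) x"
proof (cases "pmf (\<pi> (- int k)) x = 0")
  case True
  then have "(\<Sum>z\<in>states s. pmf (\<pi> (- int k - 1)) z * pmf (M (- int k) z) x) = 0"
    using absolute_probs_step[of \<pi> s M "- int k" x] assms by simp
  then have "pmf (\<pi> (- int k - 1)) z * pmf (M (- int k) z) x = 0"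
    using assms by (subst (asm) sum_nonneg_eq_0_iff) auto
  with True show ?thesis by simp
qed simp

lemma (in finite_chain) sum_backward_weight:
  assumes "\<pi> \<in> absolute_probs s M"
  shows "(\<Sum>z\<in>states s. backward_weight M \<pi> k x z) = 1"
proof (cases k)
  case 0
  with assms show ?thesis by (simp add: sum_pmf_dists absolute_probs_dists)
next
  case (Suc j)
  show ?thesis
  proof (cases "pmf (\<pi> (- int j)) x = 0")
    case True
    have "1 \<in> states s" using states_nonempty by (simp add: states_def)
    with True Suc show ?thesis by (simp add: of_bool_def)
  next
    case False
    then have "x \<in> states s"
      using pmf_dists_outside absolute_probs_dists[OF assms] by (metis neg_le_0_iff_le of_nat_0_le_iff)
    with False Suc show ?thesis
      using absolute_probs_step[OF assms, of "- int j" x] by (simp flip: sum_divide_distrib)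
  qed
qed

text \<open>The chain read backwards from time 0 and the chain read forwards from time \<open>-m\<close> give a path the same
  weight: each backward step moves the marginal \<open>\<pi>\<close> one time unit into the past and leaves a forward
  transition probability behind.\<close>

lemma prod_backward_weight:
  assumes "\<pi> \<in> absolute_probs s M" "x \<in> {- int m..0} \<rightarrow> states s"
  shows "(\<Prod>k\<le>m. backward_weight M \<pi> k (case k of 0 \<Rightarrow> 0 | Suc j \<Rightarrow> x (- int j)) (x (- int k))) =
    pmf (\<pi> (- int m)) (x (- int m)) * transition_weight M (- int m) 0 x"
  using assms(2)
proof (induction m)
  case 0
  then show ?case by (simp add: transition_weight_def)
next
  case (Suc m)
  let ?a = "- int m"
  have x: "x ?a \<in> states s" "x (?a - 1) \<in> states s" "x \<in> {?a..0} \<rightarrow> states s"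
    using Suc.prems by (auto simp: Pi_iff)
  have eq: "- int (Suc m) = ?a - 1" by simp
  have "(\<Prod>k\<le>Suc m. backward_weight M \<pi> k (case k of 0 \<Rightarrow> 0 | Suc j \<Rightarrow> x (- int j)) (x (- int k))) =
      (pmf (\<pi> ?a) (x ?a) * transition_weight M ?a 0 x) * backward_weight M \<pi> (Suc m) (x ?a) (x (?a - 1))"
    using Suc.IH[OF x(3)] unfolding eq[symmetric] prod.atMost_Suc by (simp del: backward_weight.simps)
  also have "\<dots> = (pmf (\<pi> ?a) (x ?a) * backward_weight M \<pi> (Suc m) (x ?a) (x (?a - 1))) * transition_weight M ?a 0 x"
    by (simp only: mult.assoc mult.commute mult.left_commute)
  also have "\<dots> = pmf (\<pi> (?a - 1)) (x (?a - 1)) * (pmf (M ?a (x (?a - 1))) (x ?a) * transition_weight M ?a 0 x)"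
    unfolding backward_weight_balance[OF assms(1) x(1,2)] by (rule mult.assoc)
  also have "\<dots> = pmf (\<pi> (?a - 1)) (x (?a - 1)) * transition_weight M (?a - 1) 0 x"
    by (subst transition_weight_first) auto
  finally show ?case unfolding eq .
qed

text \<open>Each lag consults its own entry of the table, so that a prescribed finite path is a rectangle event of
  the product measure.\<close>

lemma backward_path_eq_iff:
  "(\<forall>k\<le>m. backward_path U k = y k) \<longleftrightarrow> (\<forall>k\<le>m. U (k, case k of 0 \<Rightarrow> 0 | Suc j \<Rightarrow> y j) = y k)"
proof (induction m)
  case (Suc m)
  then show ?case by (auto simp: le_Suc_eq)
qed simp

text \<open>The law of the path that follows a table of independent instructions, each distributed according to
  the corresponding backward weights.\<close>

lemma (in finite_chain) ex_path_law:
  assumes \<pi>: "\<pi> \<in> absolute_probs s M"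
  shows "\<exists>P. is_path_law s M \<pi> P"
proof -
  define N where "N i = point_measure (states s) (\<lambda>z. ennreal (backward_weight M \<pi> (fst i) (snd i) z))" for i
  have N_prob: "prob_space (N i)" for i
    unfolding N_def using sum_backward_weight[OF \<pi>]
    by (intro prob_space_point_measure) (auto simp: backward_weight_nonneg sum_ennreal)
  have sets_N: "sets (N i) = sets (count_space (states s))" for i
    by (simp add: N_def sets_point_measure)
  interpret W: product_prob_space N UNIV
    by (rule product_prob_spaceI) (rule N_prob)
  define W where "W = PiM UNIV N"
  define path where "path U = (\<lambda>n\<in>time_axis. backward_path U (nat (- n)))" for U
  have coord: "(\<lambda>U. U i) \<in> measurable W (count_space (states s))" for i
    unfolding W_def measurable_cong_sets[OF refl sets_N[of i, symmetric]]
    by (rule measurable_component_singleton) simp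
  have trace: "(\<lambda>U. backward_path U k) \<in> measurable W (count_space (states s))" for k
  proof (induction k)
    case 0
    show ?case using coord by simp
  next
    case (Suc k)
    have "(\<lambda>U. U (Suc k, backward_path U k)) \<in> measurable W (count_space (states s))"
      by (rule measurable_compose_countable'[where f="\<lambda>z U. U (Suc k, z)" and I="states s"])
        (auto intro: coord Suc countable_finite)
    then show ?case by simp
  qed
  have path [measurable]: "path \<in> measurable W (path_space s)"
    unfolding path_def path_space_def using trace by (intro measurable_restrict) auto
  let ?P = "distr W (path_space s) path"
  have "measure ?P {\<omega> \<in> space (path_space s). \<forall>k\<in>{n..0}. \<omega> k = x k} =
      pmf (\<pi> n) (x n) * (\<Prod>k\<in>{n+1..0}. pmf (M k (x (k - 1))) (x k))"
    if n: "n \<in> time_axis" and x: "x \<in> {n..0} \<rightarrow> states s" for n x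
  proof -
    define m where "m = nat (- n)"
    have n_eq: "n = - int m" using n by (simp add: m_def time_axis_def)
    define prev where "prev k = (case k of 0 \<Rightarrow> 0 | Suc j \<Rightarrow> x (- int j))" for k
    define J where "J = (\<lambda>k. (k, prev k)) ` {..m}"
    have inj: "inj_on (\<lambda>k. (k, prev k)) {..m}" by (auto simp: inj_on_def)
    have states_x: "x (- int k) \<in> states s" if "k \<le> m" for k
      using x that by (auto simp: n_eq)
    have ev: "{\<omega> \<in> space (path_space s). \<forall>k\<in>{n..0}. \<omega> k = x k} \<in> sets (path_space s)"
    proof (cases "n \<le> 0")
      case True
      then show ?thesis
        using agree_in_coord_events[of n 0 x s] x by (simp add: sets_path_space agree_def)
    qed (use n in \<open>simp add: time_axis_def\<close>)
    have "path -` {\<omega> \<in> space (path_space s). \<forall>k\<in>{n..0}. \<omega> k = x k} \<inter> space W =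
        {U \<in> space W. \<forall>k\<in>{n..0}. path U k = x k}"
      using measurable_space[OF path] by auto
    also have "\<dots> = {U \<in> space W. \<forall>k\<le>m. backward_path U k = x (- int k)}"
    proof -
      have "(\<forall>k\<in>{n..0}. path U k = x k) \<longleftrightarrow> (\<forall>k\<le>m. backward_path U k = x (- int k))" for U
      proof
        assume l: "\<forall>k\<in>{n..0}. path U k = x k"
        show "\<forall>k\<le>m. backward_path U k = x (- int k)"
        proof (intro allI impI)
          fix k assume "k \<le> m"
          with l[rule_format, of "- int k"] show "backward_path U k = x (- int k)"
            by (simp add: path_def n_eq time_axis_def)
        qed
      next
        assume r: "\<forall>k\<le>m. backward_path U k = x (- int k)"
        show "\<forall>k\<in>{n..0}. path U k = x k"
        proof
          fix k assume "k \<in> {n..0}"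
          with r[rule_format, of "nat (- k)"] show "path U k = x k"
            by (auto simp add: path_def n_eq time_axis_def)
        qed
      qed
      then show ?thesis by simp
    qed
    also have "\<dots> = {U \<in> space W. \<forall>k\<le>m. U (k, prev k) = x (- int k)}"
      unfolding backward_path_eq_iff prev_def ..
    also have "\<dots> = prod_emb UNIV N J (\<Pi>\<^sub>E j\<in>J. {x (- int (fst j))})"
      by (auto simp: prod_emb_def W_def space_PiM J_def PiE_iff)
    finally have pre: "path -` {\<omega> \<in> space (path_space s). \<forall>k\<in>{n..0}. \<omega> k = x k} \<inter> space W =
        prod_emb UNIV N J (\<Pi>\<^sub>E j\<in>J. {x (- int (fst j))})" .
    have "measure ?P {\<omega> \<in> space (path_space s). \<forall>k\<in>{n..0}. \<omega> k = x k} =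
        measure W (prod_emb UNIV N J (\<Pi>\<^sub>E j\<in>J. {x (- int (fst j))}))"
      using measure_distr[OF path ev] pre by simp
    also have "\<dots> = (\<Prod>j\<in>J. measure (N j) {x (- int (fst j))})"
      unfolding W_def using states_x
      by (intro W.measure_PiM_emb) (auto simp: J_def sets_N)
    also have "\<dots> = (\<Prod>k\<le>m. measure (N (k, prev k)) {x (- int k)})"
      unfolding J_def using inj by (simp add: prod.reindex)
    also have "\<dots> = (\<Prod>k\<le>m. backward_weight M \<pi> k (prev k) (x (- int k)))"
    proof (intro prod.cong refl)
      fix k assume "k \<in> {..m}"
      then have "emeasure (N (k, prev k)) {x (- int k)} = ennreal (backward_weight M \<pi> k (prev k) (x (- int k)))"
        using states_x by (simp add: N_def emeasure_point_measure_finite)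
      then show "measure (N (k, prev k)) {x (- int k)} = backward_weight M \<pi> k (prev k) (x (- int k))"
        by (simp add: measure_def backward_weight_nonneg)
    qed
    also have "\<dots> = pmf (\<pi> n) (x n) * transition_weight M n 0 x"
      unfolding prev_def n_eq using x by (intro prod_backward_weight[OF \<pi>]) (simp add: n_eq)
    finally show ?thesis by (simp add: transition_weight_def)
  qed
  moreover have "prob_space ?P"
    using path by (intro W.P.prob_space_distr[folded W_def]) 
  ultimately have "is_path_law s M \<pi> ?P"
    unfolding is_path_law_def by simp
  then show ?thesis ..
qed

lemma (in finite_chain) is_path_law_path_law:
  "\<pi> \<in> absolute_probs s M \<Longrightarrow> is_path_law s M \<pi> (path_law s M \<pi>)"
  using ex_path_law path_law_eqI by metis

section \<open>Existence of absolute probabilities\<close>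

lemma ex_pmf_on:
  assumes "finite S" "\<And>z. z \<in> S \<Longrightarrow> 0 \<le> f z" "sum f S = 1"
  shows "\<exists>p. set_pmf p \<subseteq> S \<and> (\<forall>z\<in>S. pmf p z = f z)"
proof -
  let ?g = "\<lambda>z. if z \<in> S then f z else 0"
  have nonneg: "0 \<le> ?g z" for z using assms(2) by simp
  have "(\<integral>\<^sup>+z. ennreal (?g z) \<partial>count_space UNIV) = (\<Sum>z\<in>S. ennreal (?g z))"
    using assms(1) by (intro nn_integral_count_space') auto
  also have "\<dots> = 1"
    using assms by (simp add: sum_ennreal)
  finally have total: "(\<integral>\<^sup>+z. ennreal (?g z) \<partial>count_space UNIV) = 1" .
  show ?thesis
    using pmf_embed_pmf[of ?g, OF nonneg total] set_embed_pmf[of ?g, OF nonneg total]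
    by (intro exI[of _ "embed_pmf ?g"]) auto
qed

text \<open>Starting the chain in state 1 at time \<open>-N\<close> gives families of distributions that solve the equations at
  the times after \<open>-N\<close>. The sets of these partial solutions are closed and decreasing in the compact
  product space \<open>[0,1]^(\<int> \<times> \<nat>)\<close>, so they have a common point, which solves all equations.\<close>

lemma (in finite_chain) absolute_probs_nonempty: "absolute_probs s M \<noteq> {}"
proof -
  define D :: "(int \<times> nat \<Rightarrow> real) set" where "D = UNIV \<rightarrow>\<^sub>E {0..1}"
  define K where "K N = {f :: int \<times> nat \<Rightarrow> real.
      (\<forall>n\<in>{..0}. (\<Sum>z\<in>states s. f (n, z)) = 1) \<and>
      (\<forall>n\<in>{- int N<..0}. \<forall>x\<in>states s. (\<Sum>z\<in>states s. f (n - 1, z) * pmf (M n z) x) = f (n, x))}" for N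
  have "compactin (product_topology (\<lambda>_. euclidean) UNIV) D"
    unfolding D_def compactin_PiE by simp
  then have "compact D"
    by (simp add: euclidean_product_topology)
  moreover have "closed (K N)" for N
    unfolding K_def Ball_def
    by (intro closed_Collect_conj closed_Collect_all closed_Collect_imp closed_Collect_eq
        continuous_intros continuous_on_product_coordinates open_Collect_const)
  moreover have "D \<inter> (\<Inter>j\<in>I. K j) \<noteq> {}" if fin: "finite I" for I
  proof -
    obtain N where N: "\<And>j. j \<in> I \<Longrightarrow> j \<le> N"
      using fin by (meson finite_nat_set_iff_bounded_le)
    define g where "g = rec_nat (return_pmf 1) (\<lambda>j p. bind_pmf p (M (- int N + int j + 1)))"
    have g_0: "g 0 = return_pmf 1" and g_Suc: "g (Suc j) = bind_pmf (g j) (M (- int N + int j + 1))" for j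
      by (simp_all add: g_def)
    have g_dists: "g j \<in> dists s" if "j \<le> N" for j
      using that
    proof (induction j)
      case 0
      show ?case using states_nonempty by (simp add: g_0 dists_def states_def)
    next
      case (Suc j)
      then show ?case
        using kernel_support[of "- int N + int j + 1"] by (auto simp: g_Suc dists_def)
    qed
    \<comment> \<open>truncation by \<open>nat\<close> makes \<open>f\<close> constant in time before \<open>-N\<close>, where only the normalisation matters\<close>
    define f where "f = (\<lambda>(n, x). pmf (g (nat (n + int N))) x)"
    have "(\<Sum>z\<in>states s. f (n - 1, z) * pmf (M n z) x) = f (n, x)"
      if "n \<in> {- int N<..0}" "x \<in> states s" for n x
    proof -
      define j where "j = nat (n - 1 + int N)"
      have n: "- int N + int j + 1 = n" and Suc: "nat (n + int N) = Suc j" and "j \<le> N"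
        using that by (auto simp: j_def)
      have "f (n, x) = (\<integral>z. pmf (M n z) x \<partial>measure_pmf (g j))"
        by (simp only: f_def prod.case Suc g_Suc n pmf_bind)
      also have "\<dots> = (\<Sum>z\<in>states s. pmf (M n z) x * pmf (g j) z)"
        using g_dists[OF \<open>j \<le> N\<close>] by (intro integral_measure_pmf_real) (auto simp: dists_def)
      finally show ?thesis by (simp add: f_def mult.commute flip: j_def)
    qed
    moreover have "(\<Sum>z\<in>states s. f (n, z)) = 1" if "n \<le> 0" for n
      using that by (simp add: f_def sum_pmf_dists g_dists)
    ultimately have "f \<in> K j" if "j \<le> N" for j
      using that by (auto simp: K_def)
    moreover have "f \<in> D"
      by (auto simp: D_def f_def pmf_le_1)
    ultimately show ?thesis using N by blast
  qed
  ultimately have "D \<inter> (\<Inter>j. K j) \<noteq> {}"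
    by (rule compact_imp_fip_image) auto
  then obtain f where f: "f \<in> D" "\<And>j. f \<in> K j" by auto
  have "\<exists>p. set_pmf p \<subseteq> states s \<and> (\<forall>z\<in>states s. pmf p z = f (n, z))" if "n \<le> 0" for n
    using f(1) f(2)[of 0] that by (intro ex_pmf_on) (auto simp: D_def K_def PiE_iff)
  then obtain p where p: "\<And>n. n \<le> 0 \<Longrightarrow> set_pmf (p n) \<subseteq> states s"
      "\<And>n z. n \<le> 0 \<Longrightarrow> z \<in> states s \<Longrightarrow> pmf (p n) z = f (n, z)"
    by metis
  have "(\<Sum>z\<in>states s. f (n - 1, z) * pmf (M n z) x) = f (n, x)" if "n \<le> 0" "x \<in> states s" for n x
    using f(2)[of "nat (1 - n)"] that by (auto simp: K_def)
  then have "restrict p time_axis \<in> absolute_probs s M"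
    by (auto simp: absolute_probs_def time_axis_def dists_def p subsetD[OF p(1)])
  then show ?thesis by blast
qed

section \<open>Uniqueness implies a trivial remote past\<close>

text \<open>The new absolute probabilities are \<open>\<rho>_n(z) = P(X_n = z | A)\<close>. Both the equations for \<open>\<rho>\<close> and the path
  law formula are instances of the Markov property, because \<open>A\<close> belongs to the past of
  every time.\<close>

lemma (in path_law_of) conditioned_law:
  assumes A: "A \<in> remote_past_events s" and pos: "prob A > 0"
  shows "\<exists>\<rho>\<in>absolute_probs s M. is_path_law s M \<rho> (uniform_measure P A)"
proof -
  have A_past: "A \<in> coord_events s {..n}" if "n \<le> 0" for n
    using A that by (auto simp: remote_past_events_def time_axis_def)
  have A_sets: "A \<in> sets P" using coord_events_sets[OF order_refl A_past] by simp
  have cond: "measure (uniform_measure P A) B = prob (A \<inter> B) / prob A" if "B \<in> sets P" for B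
    using A_sets that pos by (simp add: emeasure_eq_measure)
  define r where "r n z = prob (A \<inter> agree s n n (\<lambda>_. z)) / prob A" for n z
  have "\<exists>p. set_pmf p \<subseteq> states s \<and> (\<forall>z\<in>states s. pmf p z = r n z)" if "n \<le> 0" for n
  proof (rule ex_pmf_on)
    show "sum (r n) (states s) = 1"
      using prob_eq_sum_coord[OF A_sets that] pos by (simp add: r_def flip: sum_divide_distrib)
  qed (simp_all add: r_def)
  then obtain p where p: "\<And>n. n \<le> 0 \<Longrightarrow> set_pmf (p n) \<subseteq> states s"
      "\<And>n z. n \<le> 0 \<Longrightarrow> z \<in> states s \<Longrightarrow> pmf (p n) z = r n z"
    by metis
  have step: "(\<Sum>z\<in>states s. r (n - 1) z * pmf (M n z) x) = r n x" if n: "n \<le> 0" and x: "x \<in> states s" for n x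
  proof -
    have "prob (A \<inter> agree s n n (\<lambda>_. x)) =
        (\<Sum>z\<in>states s. prob (A \<inter> agree s n n (\<lambda>_. x) \<inter> agree s (n - 1) (n - 1) (\<lambda>_. z)))"
      using n A_sets by (intro prob_eq_sum_coord) (auto intro: agree_sets)
    also have "\<dots> = (\<Sum>z\<in>states s. prob (A \<inter> agree s (n - 1) (n - 1) (\<lambda>_. z)) * pmf (M n z) x)"
    proof (intro sum.cong refl)
      fix z assume z: "z \<in> states s"
      let ?y = "\<lambda>k. if k = n then x else z"
      have "A \<inter> agree s n n (\<lambda>_. x) \<inter> agree s (n - 1) (n - 1) (\<lambda>_. z) = A \<inter> agree s (n - 1) n ?y"
      proof -
        have "{n - 1..n} = {n - 1, n}" by auto
        then show ?thesis by (auto simp: agree_def)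
      qed
      moreover have "agree s (n - 1) (n - 1) ?y = agree s (n - 1) (n - 1) (\<lambda>_. z)"
        by (auto simp: agree_def)
      moreover have "transition_weight M (n - 1) n ?y = pmf (M n z) x"
        by (simp add: transition_weight_def)
      ultimately show "prob (A \<inter> agree s n n (\<lambda>_. x) \<inter> agree s (n - 1) (n - 1) (\<lambda>_. z)) =
          prob (A \<inter> agree s (n - 1) (n - 1) (\<lambda>_. z)) * pmf (M n z) x"
        using markov_property[of "n - 1" n ?y A] n x z A_past[of "n - 1"] by simp
    qed
    finally show ?thesis by (simp add: r_def sum_divide_distrib)
  qed
  have "restrict p time_axis \<in> absolute_probs s M"
    using step by (auto simp: absolute_probs_def time_axis_def dists_def p subsetD[OF p(1)])
  moreover have "is_path_law s M (restrict p time_axis) (uniform_measure P A)"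
  proof -
    have "measure (uniform_measure P A) {\<omega> \<in> space (path_space s). \<forall>k\<in>{n..0}. \<omega> k = x k} =
        pmf (p n) (x n) * (\<Prod>k\<in>{n+1..0}. pmf (M k (x (k - 1))) (x k))"
      if n: "n \<le> 0" and x: "x \<in> {n..0} \<rightarrow> states s" for n x
    proof -
      have "measure (uniform_measure P A) (agree s n 0 x) = prob (A \<inter> agree s n 0 x) / prob A"
        using n by (intro cond agree_sets) auto
      also have "\<dots> = prob (A \<inter> agree s n n x) / prob A * transition_weight M n 0 x"
        using markov_property[OF n order_refl x A_past[OF n]] by simp
      also have "agree s n n x = agree s n n (\<lambda>_. x n)"
        by (simp add: agree_def)
      also have "prob (A \<inter> \<dots>) / prob A = pmf (p n) (x n)"
        using n x by (subst p(2)) (auto simp: r_def)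
      finally show ?thesis by (simp add: agree_def transition_weight_def)
    qed
    moreover have "prob_space (uniform_measure P A)"
      using pos by (intro prob_space_uniform_measure) (auto simp: emeasure_eq_measure)
    ultimately show ?thesis
      using law by (auto simp: is_path_law_def time_axis_def)
  qed
  ultimately show ?thesis by blast
qed

text \<open>With only one path law available, conditioning on a remote event that is not null returns the same
  law, so the event has probability one.\<close>

lemma (in path_law_of) remote_past_trivial:
  assumes unique: "absolute_probs s M = {\<pi>}" and A: "A \<in> remote_past_events s"
  shows "prob A = 0 \<or> prob A = 1"
proof (cases "prob A = 0")
  case False
  then have pos: "prob A > 0" by (simp add: zero_less_measure_iff)
  then have "is_path_law s M \<pi> (uniform_measure P A)"
    using conditioned_law[OF A] unique by auto
  then have eq: "uniform_measure P A = P"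
    using is_path_law_unique law by blast
  have "A \<in> sets P"
    using A coord_events_sets[of 0] by (auto simp: remote_past_events_def time_axis_def)
  then have "measure (uniform_measure P A) A = 1"
    using pos by (simp add: emeasure_eq_measure)
  with eq show ?thesis by simp
qed simp

section \<open>A trivial remote past implies uniqueness\<close>

definition cylinder :: "nat \<Rightarrow> int \<Rightarrow> (int \<Rightarrow> nat) set \<Rightarrow> (int \<Rightarrow> nat) set" where
  "cylinder s n S = {\<omega> \<in> space (path_space s). restrict \<omega> {n..0} \<in> S}"

lemma cylinder_extend:
  assumes "m \<le> n"
  shows "cylinder s n S = cylinder s m {x. restrict x {n..0} \<in> S}"
proof -
  have "restrict (restrict \<omega> {m..0}) {n..0} = restrict \<omega> {n..0}" for \<omega> :: "int \<Rightarrow> nat"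
    using assms by (auto simp: restrict_def fun_eq_iff)
  then show ?thesis by (simp add: cylinder_def)
qed

lemma cylinder_Un: "cylinder s n S \<union> cylinder s n T = cylinder s n (S \<union> T)"
  by (auto simp: cylinder_def)

lemma cylinder_Int: "cylinder s n S \<inter> cylinder s n T = cylinder s n (S \<inter> T)"
  by (auto simp: cylinder_def)

lemma cylinder_eq_UN_agree:
  "n \<le> 0 \<Longrightarrow> cylinder s n S = (\<Union>x\<in>S \<inter> ({n..0} \<rightarrow>\<^sub>E states s). agree s n 0 x)"
proof (intro set_eqI iffI)
  fix \<omega> assume "\<omega> \<in> cylinder s n S"
  then have "restrict \<omega> {n..0} \<in> S \<inter> ({n..0} \<rightarrow>\<^sub>E states s)" "\<omega> \<in> agree s n 0 (restrict \<omega> {n..0})"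
    using path_in_states by (auto simp: cylinder_def agree_def)
  then show "\<omega> \<in> (\<Union>x\<in>S \<inter> ({n..0} \<rightarrow>\<^sub>E states s). agree s n 0 x)" by blast
next
  fix \<omega> assume "\<omega> \<in> (\<Union>x\<in>S \<inter> ({n..0} \<rightarrow>\<^sub>E states s). agree s n 0 x)"
  then obtain x where x: "x \<in> S" "x \<in> {n..0} \<rightarrow>\<^sub>E states s" "\<omega> \<in> agree s n 0 x" by blast
  then have "restrict \<omega> {n..0} = x"
    by (intro PiE_ext[of _ "{n..0}" "\<lambda>_. UNIV"]) (auto simp: agree_def PiE_iff)
  with x show "\<omega> \<in> cylinder s n S" by (simp add: cylinder_def agree_def)
qed

context path_law_of
begin

lemma cylinder_sets: "n \<le> 0 \<Longrightarrow> cylinder s n S \<in> sets P"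
  unfolding cylinder_eq_UN_agree by (intro sets.finite_UN agree_sets) (auto intro!: finite_PiE finite_Int disjI2)

lemma prob_cylinder:
  assumes n: "n \<le> 0"
  shows "prob (cylinder s n S) =
    (\<Sum>x\<in>S \<inter> ({n..0} \<rightarrow>\<^sub>E states s). pmf (\<pi> n) (x n) * transition_weight M n 0 x)"
proof -
  have "disjoint_family_on (agree s n 0) (S \<inter> ({n..0} \<rightarrow>\<^sub>E states s))"
    unfolding disjoint_family_on_def
  proof (intro ballI impI)
    fix x y assume xy: "x \<in> S \<inter> ({n..0} \<rightarrow>\<^sub>E states s)" "y \<in> S \<inter> ({n..0} \<rightarrow>\<^sub>E states s)" "x \<noteq> y"
    then have "\<not> (\<forall>k\<in>{n..0}. x k = y k)"
      by (blast intro: PiE_ext)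
    then show "agree s n 0 x \<inter> agree s n 0 y = {}"
      by (subst agree_Int_agree) auto
  qed
  then have "prob (cylinder s n S) = (\<Sum>x\<in>S \<inter> ({n..0} \<rightarrow>\<^sub>E states s). prob (agree s n 0 x))"
    unfolding cylinder_eq_UN_agree[OF n] using n
    by (intro finite_measure_finite_Union) (auto intro!: finite_PiE finite_Int disjI2 agree_sets)
  also have "\<dots> = (\<Sum>x\<in>S \<inter> ({n..0} \<rightarrow>\<^sub>E states s). pmf (\<pi> n) (x n) * transition_weight M n 0 x)"
    using n by (intro sum.cong refl prob_agree) (auto simp: PiE_iff)
  finally show ?thesis .
qed

end

locale two_laws = P: path_law_of s M \<pi> P + P': path_law_of s M \<pi>' P'
  for s M \<pi> P \<pi>' P'
begin

definition gap :: "(int \<Rightarrow> nat) set \<Rightarrow> real" where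
  "gap A = P.prob A - P'.prob A"

text \<open>The positive part, at time \<open>n\<close>, of a Hahn decomposition of the signed measure \<open>gap\<close>.\<close>

definition excess :: "int \<Rightarrow> (int \<Rightarrow> nat) set" where
  "excess n = cylinder s n {x. pmf (\<pi>' n) (x n) < pmf (\<pi> n) (x n)}"

definition gap_sup :: real where
  "gap_sup = (SUP n\<in>{..0}. gap (excess n))"

lemma gap_cylinder:
  assumes "n \<le> 0"
  shows "gap (cylinder s n S) = (\<Sum>x\<in>S \<inter> ({n..0} \<rightarrow>\<^sub>E states s).
    (pmf (\<pi> n) (x n) - pmf (\<pi>' n) (x n)) * transition_weight M n 0 x)"
  using assms by (simp add: gap_def P.prob_cylinder P'.prob_cylinder left_diff_distrib sum_subtractf)

text \<open>Each path contributes the difference of the marginals at time \<open>n\<close> times a nonnegative weight that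
  is the same for both laws. Discarding the paths with a negative difference and adding the missing ones with a positive
  difference only increases the sum.\<close>

lemma gap_cylinder_le_excess:
  assumes n: "n \<le> 0"
  shows "gap (cylinder s n S) \<le> gap (excess n)"
proof -
  let ?E = "{n..0} \<rightarrow>\<^sub>E states s"
  let ?H = "{x. pmf (\<pi>' n) (x n) < pmf (\<pi> n) (x n)}"
  let ?g = "\<lambda>x. (pmf (\<pi> n) (x n) - pmf (\<pi>' n) (x n)) * transition_weight M n 0 x"
  have fin: "finite ?E" by (auto intro: finite_PiE)
  have "(\<Sum>x\<in>S \<inter> ?E. ?g x) \<le> (\<Sum>x\<in>S \<inter> ?E. if x \<in> ?H then ?g x else 0)"
    by (intro sum_mono) (auto intro: mult_nonpos_nonneg transition_weight_nonneg)
  also have "\<dots> \<le> (\<Sum>x\<in>?E. if x \<in> ?H then ?g x else 0)"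
    using fin by (intro sum_mono2) (auto intro: mult_nonneg_nonneg transition_weight_nonneg)
  also have "\<dots> = (\<Sum>x\<in>?E \<inter> ?H. ?g x)"
    using fin by (simp add: sum.inter_restrict)
  finally show ?thesis
    unfolding excess_def by (simp add: gap_cylinder n Int_commute)
qed

lemma bdd_above_gap_excess: "bdd_above ((\<lambda>n. gap (excess n)) ` {..0})"
proof (rule bdd_aboveI2)
  fix n
  show "gap (excess n) \<le> 1"
    using P.prob_le_1[of "excess n"] measure_nonneg[of P' "excess n"] unfolding gap_def by linarith
qed

lemma gap_cylinder_le_sup: "n \<le> 0 \<Longrightarrow> gap (cylinder s n S) \<le> gap_sup"
  unfolding gap_sup_def
  by (rule order_trans[OF gap_cylinder_le_excess cSUP_upper[OF _ bdd_above_gap_excess]]) auto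

lemma gap_excess_mono: "m \<le> n \<Longrightarrow> n \<le> 0 \<Longrightarrow> gap (excess n) \<le> gap (excess m)"
  unfolding excess_def[of n] cylinder_extend[of m n] by (rule gap_cylinder_le_excess) simp

text \<open>The deficit from the supremum is subadditive on cylinder events, because the intersection cannot
  exceed the supremum either.\<close>

lemma gap_Un:
  assumes "n \<le> 0"
  shows "gap_sup - gap (cylinder s n S \<union> cylinder s n T) \<le>
    (gap_sup - gap (cylinder s n S)) + (gap_sup - gap (cylinder s n T))"
proof -
  have "gap (cylinder s n S \<union> cylinder s n T) =
      gap (cylinder s n S) + gap (cylinder s n T) - gap (cylinder s n S \<inter> cylinder s n T)"
    using P.cylinder_sets[OF assms] P'.cylinder_sets[OF assms]
    by (simp add: gap_def measure_Un3 P.fmeasurable_eq_sets P'.fmeasurable_eq_sets)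
  moreover have "gap (cylinder s n S \<inter> cylinder s n T) \<le> gap_sup"
    unfolding cylinder_Int using assms by (rule gap_cylinder_le_sup)
  ultimately show ?thesis by simp
qed

lemma excess_in_coord_events:
  assumes "n \<le> 0"
  shows "excess n \<in> coord_events s {..n}"
proof -
  have "excess n = {\<omega> \<in> space (path_space s). \<omega> n \<in> {z\<in>states s. pmf (\<pi>' n) z < pmf (\<pi> n) z}}"
    using assms path_in_states by (auto simp: excess_def cylinder_def)
  also have "\<dots> \<in> coord_events s {..n}"
    by (intro coord_event_in_coord_events) auto
  finally show ?thesis .
qed

text \<open>The event is the limit superior of excess events at times \<open>t k \<le> -k\<close> whose deficits are at most
  \<open>2^-k\<close>. By subadditivity the union over \<open>k \<ge> K\<close> has deficit at most \<open>2 * 2^-K\<close>, which vanishes in the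
  limit. The event is remote because omitting finitely many \<open>k\<close> does not change it and
  \<open>excess (t k)\<close> only depends on the state at time \<open>t k\<close>.\<close>

lemma ex_remote_event_gap_ge_sup: "\<exists>A\<in>remote_past_events s. gap_sup \<le> gap A"
proof -
  have "\<exists>n\<le>- int k. gap_sup - (1/2)^k < gap (excess n)" for k
  proof -
    have "gap_sup - (1/2)^k < gap_sup" by simp
    then obtain n where n: "n \<le> 0" "gap_sup - (1/2)^k < gap (excess n)"
      unfolding gap_sup_def using less_cSUP_iff[OF _ bdd_above_gap_excess] by auto
    then show ?thesis
      using gap_excess_mono[of "min n (- int k)" n] by (intro exI[of _ "min n (- int k)"]) auto
  qed
  then obtain t where t: "\<And>k. t k \<le> - int k" "\<And>k. gap_sup - (1/2)^k < gap (excess (t k))"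
    by metis
  \<comment> \<open>finite unions first, as the supremum bounds \<open>gap\<close> only on cylinder events\<close>
  define F where "F K L = (\<Union>k\<in>{K..K+L}. excess (t k))" for K L
  define U where "U K = (\<Union>L. F K L)" for K
  define A where "A = (\<Inter>K. U K)"
  have F_Suc: "F K (Suc L) = F K L \<union> excess (t (K + Suc L))" for K L
    by (auto simp: F_def atLeastAtMostSuc_conv)
  \<comment> \<open>the right-hand side is the geometric sum of the deficits\<close>
  have F: "(\<exists>n\<le>0. \<exists>S. F K L = cylinder s n S) \<and> gap_sup - gap (F K L) \<le> 2 * (1/2)^K - (1/2)^(K+L)" for K L
  proof (induction L)
    case 0
    have "t K \<le> 0" using t(1)[of K] by simp
    moreover have "F K 0 = excess (t K)" by (simp add: F_def)
    ultimately show ?case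
      using t(2)[of K] unfolding excess_def by auto
  next
    case (Suc L)
    then obtain n S where n: "n \<le> 0" "F K L = cylinder s n S" by blast
    let ?m = "t (K + Suc L)"
    obtain T where T: "excess ?m = cylinder s ?m T" by (simp add: excess_def)
    \<comment> \<open>both events are written as cylinders over the longer of the two windows\<close>
    define l where "l = min n ?m"
    have l: "l \<le> 0" using n by (simp add: l_def)
    obtain S' T' where S': "F K L = cylinder s l S'" and T': "excess ?m = cylinder s l T'"
      using cylinder_extend[of l n s S] cylinder_extend[of l ?m s T] n T by (auto simp: l_def)
    have "F K (Suc L) = cylinder s l (S' \<union> T')"
      unfolding F_Suc S' T' cylinder_Un ..
    moreover have "gap_sup - gap (F K (Suc L)) \<le> (gap_sup - gap (F K L)) + (gap_sup - gap (excess ?m))"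
      unfolding F_Suc S' T' by (rule gap_Un[OF l])
    moreover have "gap_sup - gap (excess ?m) \<le> (1/2)^(K + Suc L)"
      using t(2)[of "K + Suc L"] by simp
    moreover have "2 * (1/2)^(K + Suc L) = ((1/2)^(K + L) :: real)"
      by simp
    ultimately show ?case using Suc l by (auto intro!: exI[of _ l])
  qed
  have F_sets: "F K L \<in> sets P" "F K L \<in> sets P'" for K L
    using F[of K L] P.cylinder_sets P'.cylinder_sets by auto
  then have U_sets: "U K \<in> sets P" "U K \<in> sets P'" for K
    by (auto simp: U_def)
  have gap_U: "gap_sup - 2 * (1/2)^K \<le> gap (U K)" for K
  proof (rule LIMSEQ_le_const)
    have "incseq (F K)" by (force simp: incseq_def F_def)
    then show "(\<lambda>L. gap (F K L)) \<longlonglongrightarrow> gap (U K)"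
      unfolding gap_def U_def using F_sets
      by (intro tendsto_diff P.finite_Lim_measure_incseq P'.finite_Lim_measure_incseq) auto
    have "gap_sup - 2 * (1/2)^K \<le> gap (F K L)" for L
      using F[of K L] zero_le_power[of "1/2::real" "K + L"] by linarith
    then show "\<exists>N. \<forall>L\<ge>N. gap_sup - 2 * (1/2)^K \<le> gap (F K L)" by blast
  qed
  have U_eq: "U K = (\<Union>k\<in>{K..}. excess (t k))" for K
    by (force simp: U_def F_def dest: le_Suc_ex)
  then have dec: "decseq U" by (force simp: decseq_def)
  have "gap_sup \<le> gap A"
  proof (rule LIMSEQ_le)
    show "(\<lambda>K. gap (U K)) \<longlonglongrightarrow> gap A"
      unfolding gap_def A_def using U_sets dec
      by (intro tendsto_diff P.finite_Lim_measure_decseq P'.finite_Lim_measure_decseq) auto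
    have "(\<lambda>K. gap_sup - 2 * (1/2)^K) \<longlonglongrightarrow> gap_sup - 2 * 0"
      by (intro tendsto_intros LIMSEQ_realpow_zero) auto
    then show "(\<lambda>K. gap_sup - 2 * (1/2)^K) \<longlonglongrightarrow> gap_sup" by simp
    show "\<exists>N. \<forall>K\<ge>N. gap_sup - 2 * (1/2)^K \<le> gap (U K)" using gap_U by blast
  qed
  moreover have "A \<in> remote_past_events s"
    unfolding remote_past_events_def
  proof
    fix n assume "n \<in> time_axis"
    then have n: "n \<le> 0" by (simp add: time_axis_def)
    interpret sigma_algebra "space (path_space s)" "coord_events s {..n}"
      by (rule sigma_algebra_coord_events)
    have "A = (\<Inter>K. U (K + nat (- n)))"
      unfolding A_def using decseqD[OF dec] by (blast intro: le_add1)
    moreover have "U (K + nat (- n)) \<in> coord_events s {..n}" for K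
      unfolding U_eq
    proof (rule countable_UN', safe)
      fix k assume "K + nat (- n) \<le> k"
      then have "t k \<le> n" using t(1)[of k] by linarith
      with n show "excess (t k) \<in> coord_events s {..n}"
        using excess_in_coord_events[of "t k"] coord_events_mono[of "{..t k}" "{..n}" s] by auto
    qed auto
    ultimately show "A \<in> coord_events s {..n}"
      by (auto intro: countable_INT)
  qed
  ultimately show ?thesis by blast
qed

text \<open>Agreement on remote events leaves no room for a positive gap on any cylinder, in particular not on
  \<open>{X_n = z}\<close>.\<close>

lemma remote_past_determines_le:
  assumes "\<And>A. A \<in> remote_past_events s \<Longrightarrow> P.prob A = P'.prob A"
    and n: "n \<le> 0" and z: "z \<in> states s"
  shows "pmf (\<pi> n) z \<le> pmf (\<pi>' n) z"
proof -
  have "gap_sup \<le> 0"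
    using ex_remote_event_gap_ge_sup assms(1) by (auto simp: gap_def)
  moreover have "cylinder s n {x. x n = z} = agree s n n (\<lambda>_. z)"
    using n by (auto simp: cylinder_def agree_def)
  ultimately show ?thesis
    using gap_cylinder_le_sup[OF n, of "{x. x n = z}"] n z
    by (simp add: gap_def P.prob_coord P'.prob_coord)
qed

end

lemma (in finite_chain) absolute_probs_eqI:
  assumes \<pi>: "\<pi> \<in> absolute_probs s M" and \<pi>': "\<pi>' \<in> absolute_probs s M"
    and eq: "\<And>A. A \<in> remote_past_events s \<Longrightarrow>
      measure (path_law s M \<pi>) A = measure (path_law s M \<pi>') A"
  shows "\<pi> = \<pi>'"
proof (rule PiE_ext)
  show "\<pi> \<in> time_axis \<rightarrow>\<^sub>E dists s" "\<pi>' \<in> time_axis \<rightarrow>\<^sub>E dists s"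
    using \<pi> \<pi>' by (simp_all add: absolute_probs_def)
  fix n assume "n \<in> time_axis"
  then have n: "n \<le> 0" by (simp add: time_axis_def)
  interpret A: two_laws s M \<pi> "path_law s M \<pi>" \<pi>' "path_law s M \<pi>'"
    using \<pi> \<pi>' by unfold_locales (auto intro: is_path_law_path_law)
  interpret B: two_laws s M \<pi>' "path_law s M \<pi>'" \<pi> "path_law s M \<pi>" ..
  show "\<pi> n = \<pi>' n"
  proof (rule pmf_eqI)
    fix z
    show "pmf (\<pi> n) z = pmf (\<pi>' n) z"
    proof (cases "z \<in> states s")
      case True
      then show ?thesis
        using A.remote_past_determines_le[OF eq n True] B.remote_past_determines_le[OF eq[symmetric] n True]
        by (intro antisym) auto
    next
      case False
      then show ?thesis
        using pmf_dists_outside absolute_probs_dists n \<pi> \<pi>' by metis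
    qed
  qed
qed

theorem theorem2:
  fixes s :: nat and M :: "int \<Rightarrow> nat \<Rightarrow> nat pmf"
  assumes "s \<ge> 1" and "markov_kernels s M"
  shows "card (absolute_probs s M) = 1 \<longleftrightarrow>
    (\<forall>\<pi>\<in>absolute_probs s M. \<forall>\<pi>'\<in>absolute_probs s M. \<forall>A\<in>remote_past_events s.
       measure (path_law s M \<pi>) A = (measure (path_law s M \<pi>) A)\<^sup>2 \<and>
       (measure (path_law s M \<pi>) A)\<^sup>2 = measure (path_law s M \<pi>') A)"
    (is "_ \<longleftrightarrow> ?trivial")
proof -
  interpret finite_chain s M by unfold_locales (fact assms)+
  show ?thesis
  proof
    assume "card (absolute_probs s M) = 1"
    then obtain \<pi> where single: "absolute_probs s M = {\<pi>}"
      by (auto simp: card_1_singleton_iff)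
    interpret path_law_of s M \<pi> "path_law s M \<pi>"
      using single by unfold_locales (auto intro: is_path_law_path_law)
    show ?trivial
      using remote_past_trivial[OF single] by (fastforce simp: single)
  next
    assume trivial: ?trivial
    have "\<pi> = \<pi>'" if "\<pi> \<in> absolute_probs s M" "\<pi>' \<in> absolute_probs s M" for \<pi> \<pi>'
      using that by (intro absolute_probs_eqI) (use trivial in \<open>metis+\<close>)
    moreover obtain \<pi> where "\<pi> \<in> absolute_probs s M"
      using absolute_probs_nonempty by blast
    ultimately have "absolute_probs s M = {\<pi>}" by blast
    then show "card (absolute_probs s M) = 1" by simp
  qed
qed

end
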